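(* Let $\mathcal{B}$ be a reflexive Banach space over $\mathbb{K}\in\{\mathbb{R},\mathbb{C}\}$, let $\Lambda$ be an index set and let $\Phi=(\varphi_\lambda)_{\lambda\in\Lambda}\subset\mathcal{B}'$. If the map $\mathcal{A}_\Phi:\mathbb{P}_{\mathbb{K}}\mathcal{B}\to\mathbb{R}_+^\Lambda$, $x\mapsto(|[x,\varphi_\lambda]|)_{\lambda\in\Lambda}$, is injective, then $\Phi$ satisfies the complement property in $\mathcal{B}$.
   Context: $\mathcal{B}'$ is the topological dual of $\mathcal{B}$ and $[x,\psi]:=\psi(x)$. $\mathbb{P}_{\mathbb{K}}\mathcal{B}$ is the quotient of $\mathcal{B}$ obtained by identifying $x$ with $\tau x$ for all $\tau\in\mathbb{K}$ with $|\tau|=1$. $\mathbb{R}_+=[0,\infty)$. For $S\subset\Lambda$ let $\Phi_S=(\varphi_\lambda)_{\lambda\in S}$ and $(\mathrm{span}\,\Phi_S)_\bot=\{x\in\mathcal{B}:[x,\varphi_\lambda]=0\text{ for all }\lambda\in S\}$. $\Phi$ satisfies the complement property (CP) in $\mathcal{B}$ if for every subset $S\subset\Lambda$, either $(\mathrm{span}\,\Phi_S)_\bot=\{0\}$ or $(\mathrm{span}\,\Phi_{\Lambda\setminus S})_\bot=\{0\}$ (inclusive "or"). *)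

theory Defs
  imports "HOL-Analysis.Analysis"
begin

text \<open>
  A Banach space over \<open>\<bbbK>\<close> is a (real) Banach space \<open>'b\<close> with a multiplication by scalars from
  \<open>'k\<close> which extends the real one and for which the norm is homogeneous. The definitions are
  uniform in \<open>'k\<close> and are meant for \<open>'k = real\<close> (where \<open>smul\<close> is necessarily \<open>scaleR\<close>) and
  \<open>'k = complex\<close>.
\<close>

locale banach_space_over = vector_space smul
  for smul :: "'k::real_normed_field \<Rightarrow> 'b::banach \<Rightarrow> 'b" +
  assumes smul_of_real: "smul (of_real r) x = r *\<^sub>R x"
    and norm_smul: "norm (smul a x) = norm a * norm x"

text \<open>
  Elements of \<open>'b \<Rightarrow>\<^sub>L 'k\<close> are only real-linear, hence the dual consists of those which are
  \<open>'k\<close>-linear; it carries the operator norm of \<open>'b \<Rightarrow>\<^sub>L 'k\<close>.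
\<close>

definition dual :: "('k::real_normed_field \<Rightarrow> 'b::banach \<Rightarrow> 'b) \<Rightarrow> ('b \<Rightarrow>\<^sub>L 'k) set"
  where "dual smul = {\<psi>. \<forall>a x. blinfun_apply \<psi> (smul a x) = a * blinfun_apply \<psi> x}"

text \<open>
  The composition \<open>blinfun_mult_right a o\<^sub>L \<psi>\<close> is the scalar multiple \<open>a\<psi>\<close>. The values of a
  functional in the bidual outside \<open>dual smul\<close> are irrelevant.
\<close>

definition bidual :: "('k::real_normed_field \<Rightarrow> 'b::banach \<Rightarrow> 'b) \<Rightarrow> (('b \<Rightarrow>\<^sub>L 'k) \<Rightarrow> 'k) set"
  where "bidual smul =
    {F. (\<forall>\<psi>\<in>dual smul. \<forall>\<eta>\<in>dual smul. F (\<psi> + \<eta>) = F \<psi> + F \<eta>) \<and>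
        (\<forall>a. \<forall>\<psi>\<in>dual smul. F (blinfun_mult_right a o\<^sub>L \<psi>) = a * F \<psi>) \<and>
        continuous_on (dual smul) F}"

locale reflexive_banach_space_over = banach_space_over smul
  for smul :: "'k::real_normed_field \<Rightarrow> 'b::banach \<Rightarrow> 'b" +
  assumes reflexive: "F \<in> bidual smul \<Longrightarrow> \<exists>x. \<forall>\<psi>\<in>dual smul. F \<psi> = blinfun_apply \<psi> x"

definition phase_rel :: "('k::real_normed_field \<Rightarrow> 'b::banach \<Rightarrow> 'b) \<Rightarrow> ('b \<times> 'b) set"
  where "phase_rel smul = {(x, y). \<exists>\<tau>. norm \<tau> = 1 \<and> y = smul \<tau> x}"

definition phase_space :: "('k::real_normed_field \<Rightarrow> 'b::banach \<Rightarrow> 'b) \<Rightarrow> 'b set set"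
  where "phase_space smul = UNIV // phase_rel smul"

text \<open>
  The map \<open>\<A>\<^sub>\<Phi>\<close>, defined on equivalence classes: \<open>the_elem\<close> picks the common value of the
  measurements on all representatives, see \<open>magnitude_map_class\<close> below.
\<close>

definition magnitude_map ::
  "'l set \<Rightarrow> ('l \<Rightarrow> 'b::banach \<Rightarrow>\<^sub>L 'k::real_normed_field) \<Rightarrow> 'b set \<Rightarrow> 'l \<Rightarrow> real"
  where "magnitude_map \<Lambda> \<Phi> X =
    the_elem ((\<lambda>x. \<lambda>l\<in>\<Lambda>. norm (blinfun_apply (\<Phi> l) x)) ` X)"

definition pre_annihilator ::
  "('l \<Rightarrow> 'b::banach \<Rightarrow>\<^sub>L 'k::real_normed_field) \<Rightarrow> 'l set \<Rightarrow> 'b set"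
  where "pre_annihilator \<Phi> S = {x. \<forall>l\<in>S. blinfun_apply (\<Phi> l) x = 0}"

definition complement_property ::
  "'l set \<Rightarrow> ('l \<Rightarrow> 'b::banach \<Rightarrow>\<^sub>L 'k::real_normed_field) \<Rightarrow> bool"
  where "complement_property \<Lambda> \<Phi> \<longleftrightarrow>
    (\<forall>S\<subseteq>\<Lambda>. pre_annihilator \<Phi> S = {0} \<or> pre_annihilator \<Phi> (\<Lambda> - S) = {0})"

lemma banach_space_over_scaleR: "banach_space_over (scaleR :: real \<Rightarrow> 'b::banach \<Rightarrow> 'b)"
  by unfold_locales (simp_all add: algebra_simps)

lemma banach_space_over_complex: "banach_space_over ((*) :: complex \<Rightarrow> complex \<Rightarrow> complex)"
  by unfold_locales (simp_all add: algebra_simps norm_mult scaleR_conv_of_real)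

context banach_space_over
begin

lemma equiv_phase_rel: "equiv UNIV (phase_rel smul)"
proof (rule equivI)
  show "phase_rel smul \<subseteq> UNIV \<times> UNIV" by simp
  show "refl (phase_rel smul)"
    by (auto simp: refl_on_def phase_rel_def intro!: exI[of _ 1])
  show "sym (phase_rel smul)"
  proof (rule symI)
    fix x y assume "(x, y) \<in> phase_rel smul"
    then obtain \<tau> where t: "norm \<tau> = 1" "y = smul \<tau> x" by (auto simp: phase_rel_def)
    then have "\<tau> \<noteq> 0" by auto
    with t have "norm (inverse \<tau>) = 1" "x = smul (inverse \<tau>) y"
      by (simp_all add: norm_inverse)
    then show "(y, x) \<in> phase_rel smul" by (auto simp: phase_rel_def)
  qed
  show "trans (phase_rel smul)"
  proof (rule transI)
    fix x y z assume "(x, y) \<in> phase_rel smul" "(y, z) \<in> phase_rel smul"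
    then obtain \<tau> \<sigma> where "norm \<tau> = 1" "y = smul \<tau> x" "norm \<sigma> = 1" "z = smul \<sigma> y"
      by (auto simp: phase_rel_def)
    then have "norm (\<sigma> * \<tau>) = 1" "z = smul (\<sigma> * \<tau>) x" by (simp_all add: norm_mult)
    then show "(x, z) \<in> phase_rel smul" unfolding phase_rel_def by blast
  qed
qed

lemma magnitude_map_class:
  assumes "\<Phi> ` \<Lambda> \<subseteq> dual smul"
  shows "magnitude_map \<Lambda> \<Phi> (phase_rel smul `` {x}) =
    (\<lambda>l\<in>\<Lambda>. norm (blinfun_apply (\<Phi> l) x))"
proof -
  have eq: "(\<lambda>l\<in>\<Lambda>. norm (blinfun_apply (\<Phi> l) y)) = (\<lambda>l\<in>\<Lambda>. norm (blinfun_apply (\<Phi> l) x))"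
    if "y \<in> phase_rel smul `` {x}" for y
  proof (rule restrict_ext)
    fix l assume "l \<in> \<Lambda>"
    with assms have "\<Phi> l \<in> dual smul" by blast
    with that show "norm (blinfun_apply (\<Phi> l) y) = norm (blinfun_apply (\<Phi> l) x)"
      by (auto simp: phase_rel_def dual_def norm_mult)
  qed
  have "x \<in> phase_rel smul `` {x}"
    using equiv_class_self[OF equiv_phase_rel] by blast
  then have "(\<lambda>y. \<lambda>l\<in>\<Lambda>. norm (blinfun_apply (\<Phi> l) y)) ` (phase_rel smul `` {x}) =
      {\<lambda>l\<in>\<Lambda>. norm (blinfun_apply (\<Phi> l) x)}"
    using eq by blast
  then show ?thesis unfolding magnitude_map_def by simp
qed

lemma magnitude_map_funcset:
  assumes "\<Phi> ` \<Lambda> \<subseteq> dual smul"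
  shows "magnitude_map \<Lambda> \<Phi> \<in> phase_space smul \<rightarrow> (\<Lambda> \<rightarrow>\<^sub>E {0..})"
proof
  fix X assume "X \<in> phase_space smul"
  then obtain x where "X = phase_rel smul `` {x}"
    unfolding phase_space_def by (auto elim: quotientE)
  with assms show "magnitude_map \<Lambda> \<Phi> X \<in> \<Lambda> \<rightarrow>\<^sub>E {0..}"
    by (simp add: magnitude_map_class)
qed

end

end

theory Submission
  imports Defs
begin

text \<open>
  Suppose the complement property fails for \<open>S\<close>, so that there are nonzero \<open>u\<close> and \<open>v\<close> such that
  the functionals in \<open>S\<close> vanish at \<open>u\<close> and those outside \<open>S\<close> vanish at \<open>v\<close>. Every functional
  kills one of the two, hence \<open>u + v\<close> and \<open>u - v\<close> have the same measurements, and injectivity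
  gives \<open>u + v = \<tau>(u - v)\<close> with \<open>\<bar>\<tau>\<bar> = 1\<close>. Over the reals \<open>\<tau> = \<plusminus>1\<close>, which is absurd at once. For
  an arbitrary scalar field the remaining case is that \<open>u\<close> is a multiple of \<open>v\<close>. Then every
  functional vanishes at \<open>u\<close>, so \<open>u\<close> has the same measurements as \<open>0\<close>, and injectivity is used a
  second time to obtain \<open>u = 0\<close>. The argument is uniform in the scalar field and is given for any
  normed field over the reals, in \<open>complement_property_if_inj\<close>.
\<close>

context banach_space_over
begin

lemma equal_magnitudes_imp_unit_multiple:
  assumes "\<Phi> ` \<Lambda> \<subseteq> dual smul"
    and "inj_on (magnitude_map \<Lambda> \<Phi>) (phase_space smul)"
    and "\<And>l. l \<in> \<Lambda> \<Longrightarrow> norm (blinfun_apply (\<Phi> l) x) = norm (blinfun_apply (\<Phi> l) y)"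
  obtains \<tau> where "norm \<tau> = 1" "y = smul \<tau> x"
proof -
  have "magnitude_map \<Lambda> \<Phi> (phase_rel smul `` {x}) = magnitude_map \<Lambda> \<Phi> (phase_rel smul `` {y})"
    unfolding magnitude_map_class[OF assms(1)] using assms(3) by (rule restrict_ext)
  then have "phase_rel smul `` {x} = phase_rel smul `` {y}"
    by (rule inj_onD[OF assms(2)]) (simp_all add: phase_space_def quotientI)
  then have "(x, y) \<in> phase_rel smul"
    by (rule eq_equiv_class[OF _ equiv_phase_rel UNIV_I])
  then show thesis
    using that by (auto simp: phase_rel_def)
qed

lemma zero_magnitudes_imp_zero:
  assumes "\<Phi> ` \<Lambda> \<subseteq> dual smul"
    and "inj_on (magnitude_map \<Lambda> \<Phi>) (phase_space smul)"
    and "x \<in> pre_annihilator \<Phi> \<Lambda>"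
  shows "x = 0"
proof -
  have "norm (blinfun_apply (\<Phi> l) 0) = norm (blinfun_apply (\<Phi> l) x)" if "l \<in> \<Lambda>" for l
    using assms(3) that by (simp add: pre_annihilator_def)
  then obtain \<tau> where "x = smul \<tau> 0"
    by (rule equal_magnitudes_imp_unit_multiple[OF assms(1,2)])
  then show ?thesis by simp
qed

lemma smul_mem_pre_annihilator:
  assumes "\<Phi> ` S \<subseteq> dual smul" "x \<in> pre_annihilator \<Phi> S"
  shows "smul a x \<in> pre_annihilator \<Phi> S"
  using assms by (auto simp: pre_annihilator_def dual_def)

text \<open>
  If \<open>\<tau> \<noteq> 1\<close>, then \<open>u\<close> can be isolated in \<open>u + v = \<tau>(u - v)\<close>; if \<open>\<tau> = 1\<close>, the equation reads
  \<open>2v = 0\<close>.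
\<close>

lemma sum_eq_smul_diff_cases:
  assumes "u + v = smul \<tau> (u - v)"
  obtains "v = 0" | c where "u = smul c v"
proof (cases "\<tau> = 1")
  case True
  with assms have "v = - v" by simp
  then have "v + v = 0" by (metis add.right_inverse)
  then have "2 *\<^sub>R v = 0" by (simp add: scaleR_2)
  then show ?thesis using that(1) by simp
next
  case False
  have "smul (\<tau> - 1) u = smul (\<tau> + 1) v"
    using assms by (simp only: scale_left_diff_distrib scale_left_distrib
      scale_right_diff_distrib scale_one) (metis add.commute add_diff_eq diff_eq_eq)
  then have "smul (inverse (\<tau> - 1)) (smul (\<tau> - 1) u) = smul (inverse (\<tau> - 1) * (\<tau> + 1)) v"
    by simp
  with False have "u = smul (inverse (\<tau> - 1) * (\<tau> + 1)) v" by simp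
  then show ?thesis by (rule that(2))
qed

theorem complement_property_if_inj:
  assumes dual: "\<Phi> ` \<Lambda> \<subseteq> dual smul"
    and inj: "inj_on (magnitude_map \<Lambda> \<Phi>) (phase_space smul)"
  shows "complement_property \<Lambda> \<Phi>"
  unfolding complement_property_def
proof (intro allI impI)
  fix S assume "S \<subseteq> \<Lambda>"
  have zero: "0 \<in> pre_annihilator \<Phi> T" for T
    by (simp add: pre_annihilator_def)
  have "u = 0 \<or> v = 0"
    if u: "u \<in> pre_annihilator \<Phi> S" and v: "v \<in> pre_annihilator \<Phi> (\<Lambda> - S)" for u v
  proof -
    have "norm (blinfun_apply (\<Phi> l) (u - v)) = norm (blinfun_apply (\<Phi> l) (u + v))"
      if "l \<in> \<Lambda>" for l
      using u v that
      by (cases "l \<in> S") (simp_all add: pre_annihilator_def blinfun.add_right blinfun.diff_right)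
    then obtain \<tau> where "u + v = smul \<tau> (u - v)"
      by (rule equal_magnitudes_imp_unit_multiple[OF dual inj])
    then show ?thesis
    proof (cases rule: sum_eq_smul_diff_cases)
      case 1
      then show ?thesis ..
    next
      case (2 c)
      have "u \<in> pre_annihilator \<Phi> (\<Lambda> - S)"
        unfolding 2 using dual v by (intro smul_mem_pre_annihilator) auto
      with u have "u \<in> pre_annihilator \<Phi> \<Lambda>"
        by (auto simp: pre_annihilator_def)
      then show ?thesis
        using zero_magnitudes_imp_zero[OF dual inj] by blast
    qed
  qed
  then show "pre_annihilator \<Phi> S = {0} \<or> pre_annihilator \<Phi> (\<Lambda> - S) = {0}"
    using zero by blast
qed

end

theorem lemma2p2:
  fixes \<Lambda> :: "'l set"
    and \<Phi>\<^sub>R :: "'l \<Rightarrow> 'b::banach \<Rightarrow>\<^sub>L real"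
    and smulC :: "complex \<Rightarrow> 'c::banach \<Rightarrow> 'c"
    and \<Phi>\<^sub>C :: "'l \<Rightarrow> 'c \<Rightarrow>\<^sub>L complex"
  shows
    "(reflexive_banach_space_over (scaleR :: real \<Rightarrow> 'b \<Rightarrow> 'b) \<longrightarrow>
      \<Phi>\<^sub>R ` \<Lambda> \<subseteq> dual scaleR \<longrightarrow>
      inj_on (magnitude_map \<Lambda> \<Phi>\<^sub>R) (phase_space (scaleR :: real \<Rightarrow> 'b \<Rightarrow> 'b)) \<longrightarrow>
      complement_property \<Lambda> \<Phi>\<^sub>R) \<and>
     (reflexive_banach_space_over smulC \<longrightarrow>
      \<Phi>\<^sub>C ` \<Lambda> \<subseteq> dual smulC \<longrightarrow>
      inj_on (magnitude_map \<Lambda> \<Phi>\<^sub>C) (phase_space smulC) \<longrightarrow>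
      complement_property \<Lambda> \<Phi>\<^sub>C)"
proof (intro conjI impI)
  assume "reflexive_banach_space_over (scaleR :: real \<Rightarrow> 'b \<Rightarrow> 'b)"
  then interpret reflexive_banach_space_over "scaleR :: real \<Rightarrow> 'b \<Rightarrow> 'b" .
  assume "\<Phi>\<^sub>R ` \<Lambda> \<subseteq> dual scaleR"
    and "inj_on (magnitude_map \<Lambda> \<Phi>\<^sub>R) (phase_space (scaleR :: real \<Rightarrow> 'b \<Rightarrow> 'b))"
  then show "complement_property \<Lambda> \<Phi>\<^sub>R" by (rule complement_property_if_inj)
next
  assume "reflexive_banach_space_over smulC"
  then interpret reflexive_banach_space_over smulC .
  assume "\<Phi>\<^sub>C ` \<Lambda> \<subseteq> dual smulC" and "inj_on (magnitude_map \<Lambda> \<Phi>\<^sub>C) (phase_space smulC)"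
  then show "complement_property \<Lambda> \<Phi>\<^sub>C" by (rule complement_property_if_inj)
qed

end
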